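(* Let $G$ be a graph (not necessarily a tree) and let $v$ and $w$ be two adjacent vertices of $G$. Suppose that (i) the independence polynomial $p(G,x)$ is LC$^+$, and (ii) the polynomial $p(G,x)^2 - 4q x^2\, p(G_v,x)\, p(G_w,x)$ is LC$^+$ for all real $q\in[0,1]$. Then for all integers $n \geq 0$ the independent set sequence of $G^n(v,w)$ (which is a tree if $G$ is) is log-concave, and hence unimodal.
   Context: All graphs are simple, finite and loopless. An independent set in a graph $H$ is a set of pairwise non-adjacent vertices; $i_H(t)$ is the number of independent sets of size $t$ in $H$, $\alpha(H)$ is the size of the largest independent set, the independent set sequence of $H$ is $(i_H(t))_{t=0}^{\alpha(H)}$, and its generating function $p(H,x)=\sum_{t=0}^{\alpha(H)} i_H(t)x^t$ is the independence polynomial of $H$ (equal to $1$ for the graph with no vertices). A finite real sequence $(a_0,\dots,a_n)$ is log-concave if $a_k^2\ge a_{k-1}a_{k+1}$ for $k=1,\dots,n-1$, and unimodal if there is $m$, $0\le m\le n$, with $a_0\le a_1\le\dots\le a_m\ge a_{m+1}\ge\dots\ge a_n$. A polynomial $\sum_{k=0}^n a_kx^k$ of degree $n$ is LC$^+$ if all its coefficients $a_0,\dots,a_n$ are positive and $(a_0,\dots,a_n)$ is log-concave. For a vertex $a$ of $G$, $N[a]$ is the closed neighborhood of $a$ (the vertex $a$ together with all vertices adjacent to it), and $G_a$ denotes the graph $G-N[a]$. For adjacent vertices $v,w$ of $G$, the graph $G^n(v,w)$ (the $n$-concatenation of $G$ through $v$ and $w$) is obtained by taking $n$ vertex-disjoint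 copies of $G$, with the copies of the distinguished vertices labeled $v_1,w_1,v_2,w_2,\dots,v_n,w_n$, and adding the $n-1$ edges $w_1v_2, w_2v_3,\dots,w_{n-1}v_n$; $G^0(v,w)$ is the graph with no vertices. *)

theory Defs
  imports "HOL-Computational_Algebra.Polynomial" "Graph_Theory.Graph_Theory"
begin

text \<open>
  Finite simple loopless graphs are the symmetric digraphs of locale \<^locale>\<open>graph\<close>; vertices
  \<open>u\<close> and \<open>v\<close> are adjacent iff \<open>(u, v) \<in> arcs_ends G\<close>. The null graph is allowed.
\<close>

definition indep_sets :: "('a, 'b) pre_digraph \<Rightarrow> 'a set set" where
  "indep_sets G = {S. S \<subseteq> verts G \<and> pairwise (\<lambda>x y. (x, y) \<notin> arcs_ends G) S}"

definition indep_count :: "('a, 'b) pre_digraph \<Rightarrow> nat \<Rightarrow> nat" where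
  "indep_count G t = card {S \<in> indep_sets G. card S = t}"

definition indep_number :: "('a, 'b) pre_digraph \<Rightarrow> nat" where
  "indep_number G = Max (card ` indep_sets G)"

definition indep_poly :: "('a, 'b) pre_digraph \<Rightarrow> real poly" where
  "indep_poly G = (\<Sum>t\<le>indep_number G. monom (real (indep_count G t)) t)"

text \<open>
  A finite sequence \<open>(a\<^sub>0, \<dots>, a\<^sub>n)\<close> is given by a function \<open>a\<close> and its last index \<open>n\<close>;
  values of \<open>a\<close> beyond \<open>n\<close> are irrelevant.
\<close>

definition log_concave_seq :: "(nat \<Rightarrow> real) \<Rightarrow> nat \<Rightarrow> bool" where
  "log_concave_seq a n \<longleftrightarrow> (\<forall>k. 1 \<le> k \<and> k < n \<longrightarrow> a (k - 1) * a (k + 1) \<le> (a k)\<^sup>2)"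

definition unimodal_seq :: "(nat \<Rightarrow> real) \<Rightarrow> nat \<Rightarrow> bool" where
  "unimodal_seq a n \<longleftrightarrow>
    (\<exists>m\<le>n. (\<forall>k<m. a k \<le> a (k + 1)) \<and> (\<forall>k. m \<le> k \<and> k < n \<longrightarrow> a (k + 1) \<le> a k))"

definition LC_plus :: "real poly \<Rightarrow> bool" where
  "LC_plus p \<longleftrightarrow>
    (\<forall>k\<le>degree p. 0 < coeff p k) \<and> log_concave_seq (coeff p) (degree p)"

definition closed_nbhd :: "('a, 'b) pre_digraph \<Rightarrow> 'a \<Rightarrow> 'a set" where
  "closed_nbhd G a = insert a {b \<in> verts G. (a, b) \<in> arcs_ends G}"

definition minus_closed_nbhd :: "('a, 'b) pre_digraph \<Rightarrow> 'a \<Rightarrow> ('a, 'b) pre_digraph" where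
  "minus_closed_nbhd G a = G \<restriction> (verts G - closed_nbhd G a)"

text \<open>
  The \<open>n\<close>-concatenation of \<open>G\<close> through \<open>v\<close> and \<open>w\<close>: the vertex \<open>(x, i)\<close> is the vertex \<open>x\<close> in the
  \<open>i\<close>-th copy of \<open>G\<close>, for \<open>1 \<le> i \<le> n\<close>. The last two sets are the two orientations of the
  linking edges.
\<close>

definition concatenation ::
    "('a, 'b) pre_digraph \<Rightarrow> 'a \<Rightarrow> 'a \<Rightarrow> nat \<Rightarrow> ('a \<times> nat, ('a \<times> nat) \<times> ('a \<times> nat)) pre_digraph"
  where
  "concatenation G v w n = with_proj \<lparr>
     pverts = verts G \<times> {1..n},
     parcs = {((x, i), (y, i)) | x y i. (x, y) \<in> arcs_ends G \<and> i \<in> {1..n}}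
       \<union> {((w, i), (v, i + 1)) | i. 1 \<le> i \<and> i < n}
       \<union> {((v, i + 1), (w, i)) | i. 1 \<le> i \<and> i < n} \<rparr>"

text \<open>
  A tree is a connected acyclic graph. The predicate \<^const>\<open>tree\<close> of the library does not fit here:
  in a symmetric digraph every edge gives a directed cycle of length two. The cycles of the
  underlying undirected graph are the directed cycles of length at least three. The null graph
  counts as connected here, in contrast to \<^const>\<open>Digraph_Component.connected\<close>.
\<close>

definition undirected_tree :: "('a, 'b) pre_digraph \<Rightarrow> bool" where
  "undirected_tree G \<longleftrightarrow> graph G
     \<and> (\<forall>x\<in>verts G. \<forall>y\<in>verts G. x \<rightarrow>\<^sup>*\<^bsub>G\<^esub> y)
     \<and> \<not> (\<exists>p. pre_digraph.cycle G p \<and> 3 \<le> length p)"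

lemma graph_concatenation:
  assumes "graph G" and "v \<in> verts G" and "w \<in> verts G"
  shows "graph (concatenation G v w n)"
proof -
  interpret graph G by fact
  let ?H = "\<lparr> pverts = verts G \<times> {1..n},
     parcs = {((x, i), (y, i)) | x y i. (x, y) \<in> arcs_ends G \<and> i \<in> {1..n}}
       \<union> {((w, i), (v, i + 1)) | i. 1 \<le> i \<and> i < n}
       \<union> {((v, i + 1), (w, i)) | i. 1 \<le> i \<and> i < n} \<rparr>"
  have sub: "parcs ?H \<subseteq> pverts ?H \<times> pverts ?H"
    using assms(2,3) by auto
  have fin: "finite (parcs ?H)"
    using sub by (rule finite_subset) simp
  have "pair_graph ?H"
  proof
    show "fst e \<in> pverts ?H" "snd e \<in> pverts ?H" if "e \<in> parcs ?H" for e
      using sub that by auto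
    show "fst e \<noteq> snd e" if "e \<in> parcs ?H" for e
      using that adj_not_same by auto
    show "finite (pverts ?H)" by simp
    show "finite (parcs ?H)" by (rule fin)
    show "symmetric ?H"
      using sym_arcs by (auto simp: symmetric_def sym_def)
  qed
  then interpret H: pair_graph ?H .
  show ?thesis
    unfolding concatenation_def by (rule H.graph_axioms)
qed

end

theory Submission
  imports Defs
begin

text \<open>
  Write \<open>p\<close>, \<open>a\<close>, \<open>b\<close> for the independence polynomials of \<open>G\<close>, \<open>G\<^sub>v\<close>, \<open>G\<^sub>w\<close> and \<open>P\<^sub>n\<close> for that of
  the \<open>n\<close>-concatenation. Sorting the independent sets by whether they contain both ends of the last
  linking edge gives \<open>P\<^sub>n\<^sub>+\<^sub>2 = p P\<^sub>n\<^sub>+\<^sub>1 - x\<^sup>2 a b P\<^sub>n\<close>, since \<open>v\<close> lies in the neighbourhood of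
  \<open>w\<close>. This is the recurrence of the Chebyshev polynomials of the second kind, whose roots yield
  \<open>P\<^sub>n = p\<^sup>\<epsilon> \<Prod>\<^sub>k (p\<^sup>2 - 4 cos\<^sup>2(k\<pi>/(n+1)) x\<^sup>2 a b)\<close> with \<open>\<epsilon> = n mod 2\<close> and \<open>1 \<le> k \<le> n div 2\<close>.
  All factors are LC\<open>\<^sup>+\<close> by assumption, and products of LC\<open>\<^sup>+\<close> polynomials are LC\<open>\<^sup>+\<close>.
\<close>

section \<open>Log-concave sequences and polynomials\<close>

text \<open>Positivity turns log-concavity into the decrease of the ratios of consecutive terms, so
  once a step fails to increase, no later step increases.\<close>

lemma log_concave_seq_imp_unimodal_seq:
  assumes pos: "\<And>k. k \<le> n \<Longrightarrow> 0 < a k" and lc: "log_concave_seq a n"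
  shows "unimodal_seq a n"
proof -
  \<comment> \<open>The peak is the first index without a strict increase; the alternative
    \<open>k = n\<close> ensures that one exists.\<close>
  define m where "m = (LEAST k. k = n \<or> a (k + 1) \<le> a k)"
  have m: "m = n \<or> a (m + 1) \<le> a m"
    unfolding m_def by (rule LeastI[where k = n]) simp
  have "m \<le> n"
    unfolding m_def by (rule Least_le) simp
  have up: "a k \<le> a (k + 1)" if "k < m" for k
    using not_less_Least[OF that[unfolded m_def]] by simp
  have down: "a (k + 1) \<le> a k" if "m \<le> k" "k < n" for k
    using that
  proof (induction k rule: dec_induct)
    case base
    then show ?case using m by simp
  next
    case (step k)
    have "a (Suc k) * a (Suc k + 1) \<le> a k * a (Suc k + 1)"
      using step pos[of "Suc k + 1"] by (intro mult_right_mono) auto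
    also have "\<dots> \<le> (a (Suc k))\<^sup>2"
      using lc step.prems unfolding log_concave_seq_def by (auto dest: spec[of _ "Suc k"])
    finally show ?case
      using pos[of "Suc k"] step.prems by (simp add: power2_eq_square)
  qed
  show ?thesis
    unfolding unimodal_seq_def using \<open>m \<le> n\<close> up down by blast
qed

lemma LC_plus_coeff_nonneg: "LC_plus p \<Longrightarrow> 0 \<le> coeff p k"
  by (cases "k \<le> degree p") (auto simp: LC_plus_def coeff_eq_0 less_imp_le)

text \<open>Decrease of the ratios of consecutive coefficients, cross-multiplied. Without quotients
  it also covers indices beyond the degree, and it gives the sign of the minors in the product
  argument.\<close>

lemma LC_plus_coeff_mult_le:
  assumes "LC_plus p" and "i \<le> j"
  shows "coeff p i * coeff p (Suc j) \<le> coeff p (Suc i) * coeff p j"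
  using \<open>i \<le> j\<close>
proof (induction j rule: dec_induct)
  case base
  then show ?case by simp
next
  case (step j)
  let ?a = "coeff p"
  show ?case
  proof (cases "Suc (Suc j) \<le> degree p")
    case True
    then have "0 < ?a j"
      using assms(1) by (simp add: LC_plus_def)
    have "?a j * ?a (Suc (Suc j)) \<le> (?a (Suc j))\<^sup>2"
      using assms(1) True unfolding LC_plus_def log_concave_seq_def
      by (auto dest: spec[of _ "Suc j"])
    then have "?a i * (?a j * ?a (Suc (Suc j))) \<le> ?a i * (?a (Suc j))\<^sup>2"
      using LC_plus_coeff_nonneg[OF assms(1)] by (intro mult_left_mono)
    also have "\<dots> = (?a i * ?a (Suc j)) * ?a (Suc j)"
      by (simp add: power2_eq_square)
    also have "\<dots> \<le> (?a (Suc i) * ?a j) * ?a (Suc j)"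
      using step.IH LC_plus_coeff_nonneg[OF assms(1)] by (intro mult_right_mono)
    finally have "?a j * (?a i * ?a (Suc (Suc j))) \<le> ?a j * (?a (Suc i) * ?a (Suc j))"
      by (simp add: mult_ac)
    then show ?thesis
      using \<open>0 < ?a j\<close> by simp
  next
    case False
    then show ?thesis
      using LC_plus_coeff_nonneg[OF assms(1)] by (simp add: coeff_eq_0)
  qed
qed

lemma LC_plus_1: "LC_plus 1"
  by (simp add: LC_plus_def log_concave_seq_def)

text \<open>The Cauchy--Binet formula for a product of a \<open>2 \<times> K\<close> and a \<open>K \<times> 2\<close> matrix.\<close>

lemma sum_mult_minus_sum_mult:
  fixes x x' y y' :: "'i \<Rightarrow> 'a :: comm_ring_1"
  shows "2 * ((\<Sum>k\<in>K. x k * y k) * (\<Sum>k\<in>K. x' k * y' k) - (\<Sum>k\<in>K. x k * y' k) * (\<Sum>k\<in>K. x' k * y k))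
    = (\<Sum>k\<in>K. \<Sum>l\<in>K. (x k * x' l - x l * x' k) * (y k * y' l - y l * y' k))"
proof -
  have eq: "(\<Sum>k\<in>K. \<Sum>l\<in>K. f k * g l) = sum f K * sum g K" for f g :: "'i \<Rightarrow> 'a"
    by (simp add: sum_product)
  have "(\<Sum>k\<in>K. \<Sum>l\<in>K. (x k * x' l - x l * x' k) * (y k * y' l - y l * y' k)) =
    (\<Sum>k\<in>K. \<Sum>l\<in>K. (x k * y k) * (x' l * y' l) - (x k * y' k) * (x' l * y l)
       - (x' k * y k) * (x l * y' l) + (x' k * y' k) * (x l * y l))"
    by (intro sum.cong refl) (simp add: algebra_simps)
  also have "\<dots> = 2 * ((\<Sum>k\<in>K. x k * y k) * (\<Sum>k\<in>K. x' k * y' k)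
      - (\<Sum>k\<in>K. x k * y' k) * (\<Sum>k\<in>K. x' k * y k))"
    by (simp only: sum.distrib sum_subtractf eq) (simp add: algebra_simps)
  finally show ?thesis by simp
qed

text \<open>Multiplying polynomials multiplies the Toeplitz matrices of their coefficients. By
  Cauchy--Binet, \<open>c_k^2 - c_(k-1) c_(k+1)\<close> for the product is a sum of products of
  minors of the factors, and log-concavity of both makes each such product nonnegative.\<close>

lemma LC_plus_mult:
  assumes p: "LC_plus p" and q: "LC_plus q"
  shows "LC_plus (p * q)"
  unfolding LC_plus_def log_concave_seq_def
proof (intro conjI allI impI)
  let ?a = "coeff p" and ?b = "coeff q"
  have pos: "\<And>k. k \<le> degree p \<Longrightarrow> 0 < ?a k" "\<And>k. k \<le> degree q \<Longrightarrow> 0 < ?b k"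
    using p q by (auto simp: LC_plus_def)
  then have "p \<noteq> 0" "q \<noteq> 0" by fastforce+
  then have deg: "degree (p * q) = degree p + degree q"
    by (rule degree_mult_eq)
  note nonneg = LC_plus_coeff_nonneg[OF p] LC_plus_coeff_nonneg[OF q]
  fix k
  {
    assume "k \<le> degree (p * q)"
    \<comment> \<open>Here both \<open>?a i\<close> and \<open>?b (k - i)\<close> lie within the
      degrees, so the convolution has a strictly positive summand.\<close>
    define i where "i = min k (degree p)"
    have i: "i \<le> k" "i \<le> degree p" "k - i \<le> degree q"
      using \<open>k \<le> degree (p * q)\<close> by (auto simp: i_def deg)
    show "0 < coeff (p * q) k"
      unfolding coeff_mult
      by (rule sum_pos2[of _ i]) (use i pos nonneg in auto)
  }
  {
    assume "1 \<le> k \<and> k < degree (p * q)"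
    then obtain n where n: "k = Suc n"
      by (cases k) auto
    let ?K = "{..Suc (Suc n)}"
    \<comment> \<open>The rows are the coefficients of \<open>p\<close> and their shift by one, the
      columns the reversed coefficients of \<open>q\<close> and their shift. The guards put a zero
      where truncated subtraction would yield index 0.\<close>
    define x x' y y' where "x = ?a" and "x' = (\<lambda>i. if i = 0 then 0 else ?a (i - 1))"
      and "y = (\<lambda>i. if i \<le> k then ?b (k - i) else 0)" and "y' = (\<lambda>i. ?b (Suc k - i))"
    have xy: "coeff (p * q) k = (\<Sum>i\<in>?K. x i * y i)"
      by (simp add: coeff_mult x_def y_def n)
    have xy': "coeff (p * q) (k + 1) = (\<Sum>i\<in>?K. x i * y' i)"
      by (simp add: coeff_mult x_def y'_def n)
    have x'y': "coeff (p * q) k = (\<Sum>i\<in>?K. x' i * y' i)"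
      by (simp add: coeff_mult x'_def y'_def n sum.atMost_Suc_shift del: sum.atMost_Suc)
    have x'y: "coeff (p * q) (k - 1) = (\<Sum>i\<in>?K. x' i * y i)"
      by (subst sum.atMost_Suc_shift) (simp add: coeff_mult x'_def y_def n)
    have minor: "0 \<le> (x i * x' j - x j * x' i) * (y i * y' j - y j * y' i)"
      if ij: "i < j" "j \<le> Suc k" for i j
    proof (rule mult_nonneg_nonneg)
      obtain j' where j': "j = Suc j'" using ij by (cases j) auto
      show "0 \<le> x i * x' j - x j * x' i"
      proof (cases i)
        case 0
        then show ?thesis using that nonneg by (simp add: x_def x'_def)
      next
        case (Suc i')
        then show ?thesis
          using LC_plus_coeff_mult_le[OF p, of i' j'] that j'
          by (simp add: x_def x'_def mult.commute)
      qed
      show "0 \<le> y i * y' j - y j * y' i"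
      proof (cases "j \<le> k")
        case False
        then show ?thesis using that nonneg by (simp add: y_def y'_def)
      next
        case True
        then have "Suc k - j = Suc (k - j)" "Suc k - i = Suc (k - i)" using that by auto
        then show ?thesis
          using LC_plus_coeff_mult_le[OF q, of "k - j" "k - i"] that True
          by (simp add: y_def y'_def mult.commute)
      qed
    qed
    \<comment> \<open>Exchanging \<open>i\<close> and \<open>j\<close> changes the sign of both
      factors, so \<open>i < j\<close> settles all off-diagonal terms; the diagonal ones
      vanish.\<close>
    have "0 \<le> (\<Sum>i\<in>?K. \<Sum>j\<in>?K. (x i * x' j - x j * x' i) * (y i * y' j - y j * y' i))"
    proof (intro sum_nonneg)
      fix i j assume "i \<in> ?K" "j \<in> ?K"
      then show "0 \<le> (x i * x' j - x j * x' i) * (y i * y' j - y j * y' i)"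
        using minor[of i j] minor[of j i]
        by (cases i j rule: linorder_cases) (auto simp: n algebra_simps)
    qed
    then have "0 \<le> coeff (p * q) k * coeff (p * q) k - coeff (p * q) (k + 1) * coeff (p * q) (k - 1)"
      unfolding sum_mult_minus_sum_mult[symmetric] xy[symmetric] x'y'[symmetric]
        xy'[symmetric] x'y[symmetric]
      by simp
    then show "coeff (p * q) (k - 1) * coeff (p * q) (k + 1) \<le> (coeff (p * q) k)\<^sup>2"
      by (simp add: power2_eq_square mult.commute)
  }
qed

lemma LC_plus_prod: "(\<And>i. i \<in> A \<Longrightarrow> LC_plus (f i)) \<Longrightarrow> LC_plus (prod f A)"
  by (induction A rule: infinite_finite_induct) (auto simp: LC_plus_1 intro: LC_plus_mult)

section \<open>Chebyshev factorization of linear recurrences\<close>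

text \<open>Chebyshev polynomials of the second kind, rescaled to be monic: \<open>U\<^sub>n (x / 2)\<close>.\<close>

fun chebyshev :: "nat \<Rightarrow> real poly" where
  "chebyshev 0 = 1"
| "chebyshev (Suc 0) = [:0, 1:]"
| "chebyshev (Suc (Suc n)) = [:0, 1:] * chebyshev (Suc n) - chebyshev n"

text \<open>Adding the addition formulas for sin(s + t) and sin(s - t) gives the recurrence on the
  right-hand side. The factor \<open>sin t\<close> stays on the left to avoid a division.\<close>

lemma poly_chebyshev_cos: "poly (chebyshev n) (2 * cos t) * sin t = sin (real (Suc n) * t)"
proof (induction n rule: chebyshev.induct)
  case 1
  then show ?case by simp
next
  case 2
  then show ?case by (simp add: sin_double)
next
  case (3 n)
  have "sin (real (Suc (Suc (Suc n))) * t)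
    = sin (real (Suc (Suc n)) * t + t)" 
    by (simp add: algebra_simps)
  moreover have "sin (real (Suc n) * t) = sin (real (Suc (Suc n)) * t - t)"
    by (simp add: algebra_simps)
  ultimately have "sin (real (Suc (Suc (Suc n))) * t)
    = 2 * cos t * sin (real (Suc (Suc n)) * t) - sin (real (Suc n) * t)"
    unfolding sin_add sin_diff by simp
  then show ?case
    using 3 by (simp add: left_diff_distrib mult.assoc)
qed

lemma degree_chebyshev_le: "degree (chebyshev n) \<le> n"
proof (induction n rule: chebyshev.induct)
  case (3 n)
  then show ?case
    by (auto intro!: degree_diff_le)
qed auto

lemma coeff_chebyshev: "coeff (chebyshev n) n = 1"
proof (induction n rule: chebyshev.induct)
  case (3 n)
  then show ?case
    using degree_chebyshev_le[of n] by (simp add: coeff_eq_0)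
qed auto

text \<open>Both sides are monic of degree \<open>n\<close> and vanish at 2 cos(k pi / (n + 1)) for
  k = 1, ..., n, so a nonzero difference would have more roots than its degree permits. The roots
  for \<open>k\<close> and \<open>n + 1 - k\<close> are opposite, which pairs them into quadratic
  factors; for odd \<open>n\<close> the middle root 0 gives the monomial.\<close>

lemma chebyshev_factorization:
  "chebyshev n = monom 1 (n mod 2)
     * (\<Prod>k = 1..n div 2. monom 1 2 - [:4 * (cos (real k * pi / real (Suc n)))\<^sup>2:])"
  (is "_ = ?R")
proof (rule ccontr)
  let ?t = "\<lambda>k. real k * pi / real (Suc n)"
  let ?f = "\<lambda>k. monom 1 2 - [:4 * (cos (?t k))\<^sup>2:]"
  define D where "D = chebyshev n - ?R"
  assume "chebyshev n \<noteq> ?R"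
  then have "D \<noteq> 0" by (simp add: D_def)
  have f: "degree (?f k) = 2 \<and> lead_coeff (?f k) = 1" for k
  proof -
    have "?f k = [:- (4 * (cos (?t k))\<^sup>2), 0, 1:]"
      by (simp add: monom_altdef power2_eq_square)
    then show ?thesis by simp
  qed
  let ?F = "prod ?f {1..n div 2}"
  have F: "degree ?F = 2 * (n div 2)" "lead_coeff ?F = 1"
    subgoal using f by (subst degree_prod_eq_sum_degree) (auto dest!: spec)
    subgoal by (simp only: lead_coeff_prod f[THEN conjunct2] prod.neutral_const)
    done
  then have "?F \<noteq> 0" by (metis leading_coeff_0_iff zero_neq_one)
  then have "degree ?R = n mod 2 + degree ?F"
    by (simp add: degree_mult_eq degree_monom_eq)
  then have "degree ?R = n"
    by (simp only: F) simp
  moreover have "lead_coeff ?R = 1"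
    by (simp only: lead_coeff_mult lead_coeff_monom F(2) mult_1)
  ultimately have R: "degree ?R = n" "coeff ?R n = 1"
    by (simp_all only:)
  then have "degree D \<le> n" "coeff D n = 0"
    using degree_chebyshev_le[of n] coeff_chebyshev[of n] R
    unfolding D_def by (simp_all only: coeff_diff diff_self degree_diff_le order_refl)
  with \<open>D \<noteq> 0\<close> have "degree D < n"
    by (metis le_neq_implies_less leading_coeff_0_iff)
  have t_range: "0 < ?t k \<and> ?t k < pi" if "k \<in> {1..n}" for k
  proof -
    have "real k * pi < real (Suc n) * pi"
      using that by (intro mult_strict_right_mono) auto
    then show ?thesis
      using that by (simp add: pos_divide_less_eq mult.commute del: of_nat_Suc)
  qed
  have "poly D (2 * cos (?t k)) = 0" if k: "k \<in> {1..n}" for k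
  proof -
    have "sin (?t k) \<noteq> 0"
      using sin_gt_zero[of "?t k"] t_range[OF k] by auto
    moreover have "poly (chebyshev n) (2 * cos (?t k)) * sin (?t k) = 0"
      unfolding poly_chebyshev_cos by (simp add: sin_npi)
    ultimately have "poly (chebyshev n) (2 * cos (?t k)) = 0"
      by simp
    moreover have "poly ?R (2 * cos (?t k)) = 0"
    proof -
      have zero: "poly ?R (2 * cos (?t k)) = 0"
        if "j \<in> {1..n div 2}" "(cos (?t k))\<^sup>2 = (cos (?t j))\<^sup>2" for j
      proof -
        have "poly (?f j) (2 * cos (?t k)) = 0"
          using that(2) by (simp add: poly_monom power_mult_distrib)
        then have "poly (prod ?f {1..n div 2}) (2 * cos (?t k)) = 0"
          unfolding poly_prod using that(1) by (intro prod_zero) auto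
        then show ?thesis by (simp only: poly_mult mult_zero_right)
      qed
      \<comment> \<open>The cases are a root listed directly, one listed through its mirror index,
        and the middle root 0.\<close>
      have "k \<le> n div 2 \<or> Suc n - k \<le> n div 2 \<or> 2 * k = Suc n"
        by presburger
      then show ?thesis
      proof (elim disjE)
        assume "k \<le> n div 2"
        then have "k \<in> {1..n div 2}" using k by simp
        then show ?thesis by (rule zero) (rule refl)
      next
        assume 2: "Suc n - k \<le> n div 2"
        have "?t (Suc n - k) = pi - ?t k"
          using k by (simp add: of_nat_diff left_diff_distrib diff_divide_distrib del: of_nat_Suc)
        then have "(cos (?t k))\<^sup>2 = (cos (?t (Suc n - k)))\<^sup>2"
          by (simp only: cos_pi_minus power2_minus)
        moreover have "Suc n - k \<in> {1..n div 2}"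
          using 2 k by auto
        ultimately show ?thesis by (intro zero)
      next
        assume 3: "2 * k = Suc n"
        have "cos (?t k) = cos (real k * pi / real (2 * k))"
          by (simp only: 3)
        also have "\<dots> = 0"
          using k by simp
        finally have "cos (?t k) = 0" .
        moreover have "n mod 2 = 1" using 3 by presburger
        ultimately show ?thesis by (simp only: poly_mult poly_monom) simp
      qed
    qed
    ultimately show ?thesis by (simp add: D_def)
  qed
  then have image: "(\<lambda>k. 2 * cos (?t k)) ` {1..n} \<subseteq> {x. poly D x = 0}"
    by (intro image_subsetI CollectI)
  have inj: "inj_on (\<lambda>k. 2 * cos (?t k)) {1..n}"
  proof (rule inj_onI)
    fix j k assume jk: "j \<in> {1..n}" "k \<in> {1..n}" and "2 * cos (?t j) = 2 * cos (?t k)"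
    then have "cos (?t j) = cos (?t k)" by linarith
    then have "?t j = ?t k"
      using t_range[OF jk(1)] t_range[OF jk(2)] cos_inj_pi[of "?t j" "?t k"] by linarith
    then show "j = k" by (simp del: of_nat_Suc)
  qed
  have "card {1..n} \<le> card {x. poly D x = 0}"
    by (rule card_inj_on_le[OF inj image poly_roots_finite[OF \<open>D \<noteq> 0\<close>]])
  then have "n \<le> card {x. poly D x = 0}"
    by simp
  also have "\<dots> \<le> degree D"
    using \<open>D \<noteq> 0\<close> by (rule card_poly_roots_bound)
  finally show False using \<open>degree D < n\<close> by simp
qed

text \<open>Rescaling by \<open>s = sqrt c\<close> gives the Chebyshev recurrence:
  \<open>u n\<close> is \<open>s ^ n\<close> times \<open>chebyshev n\<close> at
  \<open>y / s\<close>. Each quadratic factor then absorbs \<open>s\<^sup>2\<close> and the monomial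
  absorbs \<open>s ^ (n mod 2)\<close>, so the root disappears.\<close>

lemma linear_recurrence_factorization:
  fixes u :: "nat \<Rightarrow> real"
  assumes "0 < c" and "u 0 = 1" and "u (Suc 0) = y"
    and rec: "\<And>n. u (Suc (Suc n)) = y * u (Suc n) - c * u n"
  shows "u n = y ^ (n mod 2)
    * (\<Prod>k = 1..n div 2. y\<^sup>2 - 4 * (cos (real k * pi / real (Suc n)))\<^sup>2 * c)"
proof -
  define s where "s = sqrt c"
  have s: "0 < s" "s\<^sup>2 = c"
    using \<open>0 < c\<close> by (auto simp: s_def)
  have "u n = s ^ n * poly (chebyshev n) (y / s)" for n
  proof (induction n rule: chebyshev.induct)
    case (3 n)
    have "u (Suc (Suc n)) = (s * (y / s)) * u (Suc n) - s\<^sup>2 * u n"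
      using s by (simp add: rec)
    then show ?case
      unfolding 3 by (simp add: algebra_simps power2_eq_square)
  qed (use assms s in auto)
  also have "s ^ n * poly (chebyshev n) (y / s) = (s ^ (n mod 2) * (y / s) ^ (n mod 2)) *
     ((s\<^sup>2) ^ (n div 2) * (\<Prod>k = 1..n div 2. (y / s)\<^sup>2 - 4 * (cos (real k * pi / real (Suc n)))\<^sup>2))"
  proof -
    have "s ^ n = s ^ (n mod 2) * (s\<^sup>2) ^ (n div 2)"
      by (simp flip: power_mult power_add)
    then show ?thesis
      by (subst chebyshev_factorization) (simp add: poly_prod poly_monom del: of_nat_Suc)
  qed
  also have "(s\<^sup>2) ^ (n div 2) * (\<Prod>k = 1..n div 2. (y / s)\<^sup>2 - 4 * (cos (real k * pi / real (Suc n)))\<^sup>2)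
     = (\<Prod>k = 1..n div 2. s\<^sup>2 * ((y / s)\<^sup>2 - 4 * (cos (real k * pi / real (Suc n)))\<^sup>2))"
    by (simp add: prod.distrib)
  also have "\<dots> = (\<Prod>k = 1..n div 2. y\<^sup>2 - 4 * (cos (real k * pi / real (Suc n)))\<^sup>2 * c)"
  proof (intro prod.cong refl)
    fix k
    have "s\<^sup>2 * (y / s)\<^sup>2 = y\<^sup>2"
      using s(1) by (simp add: power_divide)
    then show "s\<^sup>2 * ((y / s)\<^sup>2 - 4 * (cos (real k * pi / real (Suc n)))\<^sup>2)
        = y\<^sup>2 - 4 * (cos (real k * pi / real (Suc n)))\<^sup>2 * c"
      by (simp only: right_diff_distrib) (simp only: s(2) mult_ac)
  qed
  also have "s ^ (n mod 2) * (y / s) ^ (n mod 2) = y ^ (n mod 2)"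
    using s by (simp flip: power_mult_distrib)
  finally show ?thesis .
qed

text \<open>The square root of \<open>c\<close> need not be a polynomial, so the real identity is
  applied at each \<open>x > 0\<close>; polynomials that agree at infinitely many points
  coincide.\<close>

lemma poly_linear_recurrence_factorization:
  fixes P :: "nat \<Rightarrow> real poly"
  assumes pos: "\<And>x. 0 < x \<Longrightarrow> 0 < poly c x" and P: "P 0 = 1" "P (Suc 0) = p"
    and rec: "\<And>n. P (Suc (Suc n)) = p * P (Suc n) - c * P n"
  shows "P n = p ^ (n mod 2)
    * (\<Prod>k = 1..n div 2. p\<^sup>2 - smult (4 * (cos (real k * pi / real (Suc n)))\<^sup>2) c)"
    (is "_ = ?R")
proof (rule ccontr)
  assume "P n \<noteq> ?R"
  then have "finite {x. poly (P n - ?R) x = 0}"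
    by (intro poly_roots_finite) simp
  moreover have "{0<..} \<subseteq> {x. poly (P n - ?R) x = 0}"
  proof
    fix x :: real assume "x \<in> {0<..}"
    then have "poly (P n) x = poly ?R x"
      using linear_recurrence_factorization[of "poly c x" "\<lambda>n. poly (P n) x" "poly p x" n]
        pos P rec by (simp add: poly_prod)
    then show "x \<in> {x. poly (P n - ?R) x = 0}" by simp
  qed
  ultimately have "finite {0 :: real<..}"
    by (rule rev_finite_subset)
  then show False by (simp add: infinite_Ioi)
qed

section \<open>Independence polynomials of concatenations\<close>

text \<open>Stated for arbitrary families, so that the independent sets through a given vertex have
  a generating function too.\<close>

definition card_gf :: "'a set set \<Rightarrow> real poly" where
  "card_gf F = (\<Sum>S\<in>F. monom 1 (card S))"

lemma coeff_card_gf: "finite F \<Longrightarrow> coeff (card_gf F) t = real (card {S \<in> F. card S = t})"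
  by (simp add: card_gf_def coeff_sum sum.If_cases Int_def)

lemma finite_indep_sets: "finite (verts G) \<Longrightarrow> finite (indep_sets G)"
  by (rule finite_subset[of _ "Pow (verts G)"]) (auto simp: indep_sets_def)

lemma empty_in_indep_sets: "{} \<in> indep_sets G"
  by (simp add: indep_sets_def)

lemma indep_poly_eq_card_gf:
  assumes "finite (verts G)"
  shows "indep_poly G = card_gf (indep_sets G)"
proof (rule poly_eqI)
  fix t
  have fin: "finite (indep_sets G)"
    using assms by (rule finite_indep_sets)
  have "indep_count G t = 0" if "indep_number G < t"
  proof -
    have "{S \<in> indep_sets G. card S = t} = {}"
      using fin that Max_ge[of "card ` indep_sets G"] by (fastforce simp: indep_number_def)
    then show ?thesis by (simp only: indep_count_def card.empty)
  qed
  then have "coeff (indep_poly G) t = indep_count G t"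
    by (auto simp: indep_poly_def coeff_sum not_le)
  then show "coeff (indep_poly G) t = coeff (card_gf (indep_sets G)) t"
    using fin by (simp add: coeff_card_gf indep_count_def)
qed

lemma coeff_indep_poly:
  "finite (verts G) \<Longrightarrow> coeff (indep_poly G) t = real (indep_count G t)"
  by (simp add: indep_poly_eq_card_gf coeff_card_gf finite_indep_sets indep_count_def)

text \<open>The maximum is attained, hence the top coefficient is nonzero. This identifies the last
  index of the independent set sequence with the degree that occurs in
  \<open>LC_plus\<close>.\<close>

lemma degree_indep_poly:
  assumes "finite (verts G)"
  shows "degree (indep_poly G) = indep_number G"
proof (rule antisym)
  show "degree (indep_poly G) \<le> indep_number G"
    unfolding indep_poly_def by (intro degree_sum_le) (auto intro: order.trans[OF degree_monom_le])
  have "indep_number G \<in> card ` indep_sets G"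
    unfolding indep_number_def using assms empty_in_indep_sets
    by (intro Max_in) (auto simp: finite_indep_sets)
  then have "indep_count G (indep_number G) \<noteq> 0"
    using assms by (auto simp: indep_count_def finite_indep_sets)
  then show "indep_number G \<le> degree (indep_poly G)"
    using assms by (intro le_degree) (simp add: coeff_indep_poly)
qed

text \<open>The empty set makes this a nonempty sum of positive monomials. It supplies the
  positivity of \<open>c\<close> for the Chebyshev factorization.\<close>

lemma poly_indep_poly_pos:
  assumes "finite (verts G)" and "0 < x"
  shows "0 < poly (indep_poly G) x"
  using assms empty_in_indep_sets[of G]
  by (auto simp: indep_poly_eq_card_gf card_gf_def poly_sum poly_monom finite_indep_sets
      intro!: sum_pos)

lemma card_gf_mult:
  "card_gf A * card_gf B = (\<Sum>(S, T)\<in>A \<times> B. monom 1 (card S + card T))"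
  by (simp add: card_gf_def sum_product sum.cartesian_product mult_monom)

text \<open>Removing \<open>v\<close> maps the independent sets through \<open>v\<close> bijectively
  onto those of the graph without \<open>N[v]\<close> and lowers the size by one.\<close>

lemma card_gf_vertex:
  assumes "graph G" and "v \<in> verts G"
  shows "card_gf {S \<in> indep_sets G. v \<in> S} = monom 1 1 * indep_poly (minus_closed_nbhd G v)"
proof -
  interpret graph G by fact
  let ?H = "minus_closed_nbhd G v"
  have verts: "verts ?H = verts G - closed_nbhd G v"
    by (simp add: minus_closed_nbhd_def)
  then have fin: "finite (verts ?H)" by simp
  have adj: "(x, y) \<in> arcs_ends ?H \<longleftrightarrow> (x, y) \<in> arcs_ends G \<and> x \<in> verts ?H \<and> y \<in> verts ?H" for x y
    by (force simp: minus_closed_nbhd_def arcs_ends_conv image_iff)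
  have sym: "(x, y) \<in> arcs_ends G \<longleftrightarrow> (y, x) \<in> arcs_ends G" for x y
    by (intro iffI; rule arcs_ends_symmetric[OF sym_arcs])
  have bij: "bij_betw (insert v) (indep_sets ?H) {S \<in> indep_sets G. v \<in> S}"
  proof (rule bij_betw_byWitness[where f' = "\<lambda>S. S - {v}"])
    show "insert v ` indep_sets ?H \<subseteq> {S \<in> indep_sets G. v \<in> S}"
    proof clarify
      fix S assume "S \<in> indep_sets ?H"
      then have S: "S \<subseteq> verts ?H" and S': "pairwise (\<lambda>x y. (x, y) \<notin> arcs_ends G) S"
        by (auto simp: indep_sets_def pairwise_def adj)
      have "(v, x) \<notin> arcs_ends G \<and> (x, v) \<notin> arcs_ends G" if "x \<in> S" for x
        using that S sym[of v x] by (auto simp: verts closed_nbhd_def)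
      then show "insert v S \<in> indep_sets G \<and> v \<in> insert v S"
        using S S' \<open>v \<in> verts G\<close> by (auto simp: indep_sets_def pairwise_insert verts)
    qed
    show "(\<lambda>S. S - {v}) ` {S \<in> indep_sets G. v \<in> S} \<subseteq> indep_sets ?H"
    proof clarify
      fix S assume "S \<in> indep_sets G" "v \<in> S"
      then show "S - {v} \<in> indep_sets ?H"
        by (auto simp: indep_sets_def pairwise_def adj verts closed_nbhd_def)
    qed
  qed (auto simp: indep_sets_def verts closed_nbhd_def)
  have card: "card (insert v S) = Suc (card S)" if "S \<in> indep_sets ?H" for S
  proof -
    have "S \<subseteq> verts ?H" using that by (simp add: indep_sets_def)
    then have "finite S" "v \<notin> S"
      using fin by (auto simp: verts closed_nbhd_def intro: finite_subset)
    then show ?thesis by simp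
  qed
  have "card_gf {S \<in> indep_sets G. v \<in> S} = (\<Sum>S\<in>indep_sets ?H. monom 1 (Suc (card S)))"
    unfolding card_gf_def sum.reindex_bij_betw[OF bij, symmetric] using card by simp
  then show ?thesis
    using fin by (simp add: indep_poly_eq_card_gf card_gf_def sum_distrib_left mult_monom)
qed

section \<open>Independent sets of a concatenation, split at the last copy\<close>

lemma verts_concatenation: "verts (concatenation G v w n) = verts G \<times> {1..n}"
  by (simp add: concatenation_def)

lemma adj_concatenation:
  "((x, i), (y, j)) \<in> arcs_ends (concatenation G v w n) \<longleftrightarrow>
    (x, y) \<in> arcs_ends G \<and> i = j \<and> 1 \<le> i \<and> i \<le> n
    \<or> x = w \<and> y = v \<and> j = Suc i \<and> 1 \<le> i \<and> i < n
    \<or> x = v \<and> y = w \<and> i = Suc j \<and> 1 \<le> j \<and> j < n"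
  by (auto simp: concatenation_def)

text \<open>An independent set is cut into its part in the first \<open>n\<close> copies and its
  slice in the last one; they interact only through the edge between \<open>(w, n)\<close> and
  \<open>(v, Suc n)\<close>. For \<open>n = 0\<close> no pair is excluded, as copies are numbered
  from 1.\<close>

lemma bij_betw_indep_sets_concatenation:
  assumes "v \<in> verts G" and "w \<in> verts G"
  shows "bij_betw (\<lambda>(S, T). S \<union> T \<times> {Suc n})
    {(S, T). S \<in> indep_sets (concatenation G v w n) \<and> T \<in> indep_sets G \<and> \<not> ((w, n) \<in> S \<and> v \<in> T)}
    (indep_sets (concatenation G v w (Suc n)))"
    (is "bij_betw ?f ?P ?I")
proof (rule bij_betw_byWitness[where f' = "\<lambda>U. (U \<inter> UNIV \<times> {..n}, {x. (x, Suc n) \<in> U})"])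
  \<comment> \<open>Passing to \<open>Suc n\<close> adds the arcs of one copy and one linking edge
    in both orientations; \<open>1 \<le> n\<close> suppresses that edge for the first copy.\<close>
  have adj: "((x, i), (y, j)) \<in> arcs_ends (concatenation G v w (Suc n)) \<longleftrightarrow>
      ((x, i), (y, j)) \<in> arcs_ends (concatenation G v w n)
      \<or> (x, y) \<in> arcs_ends G \<and> i = Suc n \<and> j = Suc n
      \<or> x = w \<and> y = v \<and> 1 \<le> n \<and> i = n \<and> j = Suc n
      \<or> x = v \<and> y = w \<and> 1 \<le> n \<and> i = Suc n \<and> j = n" for x y i j
    unfolding adj_concatenation le_Suc_eq less_Suc_eq by auto
  have level: "1 \<le> i \<and> i \<le> n \<and> 1 \<le> j \<and> j \<le> n"
    if "((x, i), (y, j)) \<in> arcs_ends (concatenation G v w n)" for x y i j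
    using that by (auto simp: adj_concatenation)
  show "?f ` ?P \<subseteq> ?I"
  proof clarify
    fix S T
    assume ST: "S \<in> indep_sets (concatenation G v w n)" "T \<in> indep_sets G"
      and vw: "\<not> ((w, n) \<in> S \<and> v \<in> T)"
    have S: "S \<subseteq> verts G \<times> {1..n}" and T: "T \<subseteq> verts G"
      using ST by (auto simp: indep_sets_def verts_concatenation)
    have S': "p \<in> S \<Longrightarrow> q \<in> S \<Longrightarrow> p \<noteq> q \<Longrightarrow> (p, q) \<notin> arcs_ends (concatenation G v w n)"
      and T': "x \<in> T \<Longrightarrow> y \<in> T \<Longrightarrow> x \<noteq> y \<Longrightarrow> (x, y) \<notin> arcs_ends G" for p q x y
      using ST by (auto simp: indep_sets_def pairwise_def)
    have "pairwise (\<lambda>p q. (p, q) \<notin> arcs_ends (concatenation G v w (Suc n))) (S \<union> T \<times> {Suc n})"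
    proof (rule pairwiseI, rule notI)
      fix p q
      assume pq: "p \<in> S \<union> T \<times> {Suc n}" "q \<in> S \<union> T \<times> {Suc n}" "p \<noteq> q"
        and arc: "(p, q) \<in> arcs_ends (concatenation G v w (Suc n))"
      obtain x i y j where [simp]: "p = (x, i)" "q = (y, j)"
        by (cases p, cases q)
      have "p \<in> S \<and> i \<le> n \<or> x \<in> T \<and> i = Suc n" "q \<in> S \<and> j \<le> n \<or> y \<in> T \<and> j = Suc n"
        using pq S by auto
      with arc[simplified, unfolded adj] show False
        using pq(3) S'[of p q] T'[of x y] vw level[of x i y j] by (elim disjE) auto
    qed
    moreover have "S \<union> T \<times> {Suc n} \<subseteq> verts G \<times> {1..Suc n}"
      using S T by auto
    ultimately show "S \<union> T \<times> {Suc n} \<in> ?I"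
      by (simp add: indep_sets_def verts_concatenation)
  qed
  show "(\<lambda>U. (U \<inter> UNIV \<times> {..n}, {x. (x, Suc n) \<in> U})) ` ?I \<subseteq> ?P"
  proof (clarify, intro conjI)
    fix U assume "U \<in> ?I"
    then have U: "U \<subseteq> verts G \<times> {1..Suc n}"
      and U': "\<And>p q. p \<in> U \<Longrightarrow> q \<in> U \<Longrightarrow> p \<noteq> q
        \<Longrightarrow> (p, q) \<notin> arcs_ends (concatenation G v w (Suc n))"
      by (simp_all add: indep_sets_def pairwise_def verts_concatenation)
    have "U \<inter> UNIV \<times> {..n} \<subseteq> verts G \<times> {1..n}"
      using U by auto
    moreover have "pairwise (\<lambda>p q. (p, q) \<notin> arcs_ends (concatenation G v w n)) (U \<inter> UNIV \<times> {..n})"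
    proof (rule pairwiseI, rule notI)
      fix p q assume "p \<in> U \<inter> UNIV \<times> {..n}" "q \<in> U \<inter> UNIV \<times> {..n}" "p \<noteq> q"
        and "(p, q) \<in> arcs_ends (concatenation G v w n)"
      then show False
        using U'[of p q] adj[of "fst p" "snd p" "fst q" "snd q"] by simp
    qed
    ultimately show "U \<inter> UNIV \<times> {..n} \<in> indep_sets (concatenation G v w n)"
      by (simp add: indep_sets_def verts_concatenation)
    have "pairwise (\<lambda>x y. (x, y) \<notin> arcs_ends G) {x. (x, Suc n) \<in> U}"
    proof (rule pairwiseI, rule notI)
      fix x y assume "x \<in> {x. (x, Suc n) \<in> U}" "y \<in> {x. (x, Suc n) \<in> U}" "x \<noteq> y"
        and "(x, y) \<in> arcs_ends G"
      then show False
        using U'[of "(x, Suc n)" "(y, Suc n)"] by (simp add: adj)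
    qed
    then show "{x. (x, Suc n) \<in> U} \<in> indep_sets G"
      using U by (auto simp: indep_sets_def)
    show "\<not> ((w, n) \<in> U \<inter> UNIV \<times> {..n} \<and> v \<in> {x. (x, Suc n) \<in> U})"
      using U U'[of "(w, n)" "(v, Suc n)"] by (auto simp: adj)
  qed
  show "\<forall>U\<in>?I. ?f (U \<inter> UNIV \<times> {..n}, {x. (x, Suc n) \<in> U}) = U"
  proof
    fix U assume "U \<in> ?I"
    then have "U \<subseteq> verts G \<times> {1..Suc n}"
      by (simp add: indep_sets_def verts_concatenation)
    then show "?f (U \<inter> UNIV \<times> {..n}, {x. (x, Suc n) \<in> U}) = U"
      by (auto simp: le_Suc_eq)
  qed
  show "\<forall>ST\<in>?P. (?f ST \<inter> UNIV \<times> {..n}, {x. (x, Suc n) \<in> ?f ST}) = ST"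
    by (auto simp: indep_sets_def verts_concatenation)
qed

lemma card_indep_set_concatenation:
  assumes "finite (verts G)"
    and "S \<in> indep_sets (concatenation G v w n)" and "T \<in> indep_sets G"
  shows "card (S \<union> T \<times> {Suc n}) = card S + card T"
proof -
  have S: "S \<subseteq> verts G \<times> {1..n}" and T: "T \<subseteq> verts G"
    using assms(2,3) by (auto simp: indep_sets_def verts_concatenation)
  then have "finite S" "finite T"
    using assms(1) by (auto intro: finite_subset)
  moreover have "S \<inter> T \<times> {Suc n} = {}"
    using S by auto
  ultimately show ?thesis
    by (simp add: card_Un_disjoint card_cartesian_product)
qed

lemma indep_poly_concatenation_0: "indep_poly (concatenation G v w 0) = 1"
proof -
  have "indep_sets (concatenation G v w 0) = {{}}"
    by (auto simp: indep_sets_def verts_concatenation)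
  then show ?thesis
    by (simp add: indep_poly_eq_card_gf verts_concatenation card_gf_def)
qed

text \<open>All pairs count except those containing both ends of the new linking edge; these form a
  Cartesian product, so their generating function factors.\<close>

lemma indep_poly_concatenation_Suc:
  assumes "graph G" and "v \<in> verts G" and "w \<in> verts G"
  shows "indep_poly (concatenation G v w (Suc n)) = indep_poly G * indep_poly (concatenation G v w n)
    - card_gf {S \<in> indep_sets (concatenation G v w n). (w, n) \<in> S} * card_gf {T \<in> indep_sets G. v \<in> T}"
proof -
  interpret graph G by fact
  let ?I = "indep_sets (concatenation G v w n)" and ?J = "indep_sets G"
  let ?P = "{(S, T). S \<in> ?I \<and> T \<in> ?J \<and> \<not> ((w, n) \<in> S \<and> v \<in> T)}"
  let ?N = "{S \<in> ?I. (w, n) \<in> S} \<times> {T \<in> ?J. v \<in> T}"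
  have fin: "finite ?I" "finite ?J"
    by (auto intro: finite_indep_sets simp: verts_concatenation)
  have "indep_poly (concatenation G v w (Suc n))
      = (\<Sum>(S, T)\<in>?P. monom 1 (card (S \<union> T \<times> {Suc n})))"
    using sum.reindex_bij_betw[OF bij_betw_indep_sets_concatenation[OF assms(2,3), of n],
        of "\<lambda>U. monom (1 :: real) (card U)"]
    by (simp add: indep_poly_eq_card_gf card_gf_def verts_concatenation case_prod_unfold)
  also have "\<dots> = (\<Sum>(S, T)\<in>?P. monom 1 (card S + card T))"
    by (intro sum.cong refl) (auto simp: card_indep_set_concatenation[OF finite_verts, where v = v and w = w])
  also have "?P = ?I \<times> ?J - ?N"
    by auto
  also have "(\<Sum>(S, T)\<in>?I \<times> ?J - ?N. monom 1 (card S + card T)) = card_gf ?I * card_gf ?J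
      - card_gf {S \<in> ?I. (w, n) \<in> S} * card_gf {T \<in> ?J. v \<in> T}"
    unfolding card_gf_mult using fin by (intro sum_diff) auto
  finally show ?thesis
    by (simp add: indep_poly_eq_card_gf verts_concatenation mult.commute)
qed

text \<open>
  A set that contains the last copy of \<open>w\<close> misses the last copy of \<open>v\<close>, as \<open>v\<close> and \<open>w\<close> are adjacent,
  so the linking edge imposes no condition.
\<close>

lemma card_gf_concatenation_last:
  assumes "graph G" and "v \<in> verts G" and "w \<in> verts G" and "(v, w) \<in> arcs_ends G"
  shows "card_gf {S \<in> indep_sets (concatenation G v w (Suc n)). (w, Suc n) \<in> S}
    = indep_poly (concatenation G v w n) * card_gf {T \<in> indep_sets G. w \<in> T}"
proof -
  interpret graph G by fact
  let ?I = "indep_sets (concatenation G v w n)" and ?J = "indep_sets G"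
  let ?P = "{(S, T). S \<in> ?I \<and> T \<in> ?J \<and> \<not> ((w, n) \<in> S \<and> v \<in> T)}"
  let ?f = "\<lambda>(S, T). S \<union> T \<times> {Suc n}"
  let ?Q = "?I \<times> {T \<in> ?J. w \<in> T}"
  have "v \<noteq> w"
    using adj_not_same assms(4) by blast
  then have sub: "?Q = {ST \<in> ?P. (w, Suc n) \<in> ?f ST}"
    using assms(4) by (auto simp: indep_sets_def pairwise_def verts_concatenation)
  have "bij_betw ?f ?Q (?f ` ?Q)"
    by (rule bij_betw_subset[OF bij_betw_indep_sets_concatenation[OF assms(2,3), of n]])
      (use sub in auto)
  moreover have "?f ` ?Q = {S \<in> indep_sets (concatenation G v w (Suc n)). (w, Suc n) \<in> S}"
    unfolding bij_betw_imp_surj_on[OF bij_betw_indep_sets_concatenation[OF assms(2,3), of n], symmetric] sub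
    by blast
  ultimately have bij: "bij_betw ?f ?Q {S \<in> indep_sets (concatenation G v w (Suc n)). (w, Suc n) \<in> S}"
    by simp
  have "card_gf {S \<in> indep_sets (concatenation G v w (Suc n)). (w, Suc n) \<in> S}
      = (\<Sum>(S, T)\<in>?Q. monom 1 (card (S \<union> T \<times> {Suc n})))"
    using sum.reindex_bij_betw[OF bij, of "\<lambda>U. monom (1 :: real) (card U)"]
    by (simp add: card_gf_def case_prod_unfold)
  also have "\<dots> = (\<Sum>(S, T)\<in>?Q. monom 1 (card S + card T))"
    by (intro sum.cong refl) (auto simp: card_indep_set_concatenation[OF finite_verts, where v = v and w = w])
  finally show ?thesis
    by (simp add: card_gf_mult indep_poly_eq_card_gf verts_concatenation)
qed

text \<open>There is no vertex \<open>(w, 0)\<close>, so the correction term of the one-step formula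
  vanishes.\<close>

lemma indep_poly_concatenation_1:
  assumes "graph G" and "v \<in> verts G" and "w \<in> verts G"
  shows "indep_poly (concatenation G v w (Suc 0)) = indep_poly G"
proof -
  have "{S \<in> indep_sets (concatenation G v w 0). (w, 0) \<in> S} = {}"
    by (auto simp: indep_sets_def verts_concatenation)
  then show ?thesis
    using indep_poly_concatenation_Suc[OF assms, of 0]
    by (simp only: card_gf_def indep_poly_concatenation_0) simp
qed

text \<open>In the one-step formula for \<open>Suc n\<close>, the sets through the last copy of
  \<open>w\<close> split off the first \<open>n\<close> copies freely; the conditions on
  \<open>w\<close> and \<open>v\<close> each contribute a factor x and a deleted closed
  neighbourhood.\<close>

lemma indep_poly_concatenation_Suc_Suc:
  assumes "graph G" and "v \<in> verts G" and "w \<in> verts G" and "(v, w) \<in> arcs_ends G"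
  shows "indep_poly (concatenation G v w (Suc (Suc n)))
    = indep_poly G * indep_poly (concatenation G v w (Suc n))
      - monom 1 2 * indep_poly (minus_closed_nbhd G v) * indep_poly (minus_closed_nbhd G w)
          * indep_poly (concatenation G v w n)"
proof -
  have "monom 1 2 = monom 1 1 * (monom 1 1 :: real poly)"
    by (simp add: mult_monom numeral_2_eq_2)
  then show ?thesis
    by (simp add: indep_poly_concatenation_Suc[OF assms(1-3), of "Suc n"]
        card_gf_concatenation_last[OF assms] card_gf_vertex[OF assms(1)] assms(2,3) mult_ac)
qed

text \<open>Each quadratic factor of the Chebyshev form is the hypothesis at q = cos^2(k pi / (n +
  1)), which lies in [0, 1].\<close>

lemma LC_plus_indep_poly_concatenation:
  fixes G :: "('a, 'b) pre_digraph"
  assumes "graph G" and "v \<in> verts G" and "w \<in> verts G" and "(v, w) \<in> arcs_ends G"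
    and LC: "LC_plus (indep_poly G)"
    and LC': "\<And>q :: real. 0 \<le> q \<Longrightarrow> q \<le> 1 \<Longrightarrow>
      LC_plus ((indep_poly G)\<^sup>2
        - smult (4 * q) (monom 1 2 * indep_poly (minus_closed_nbhd G v)
            * indep_poly (minus_closed_nbhd G w)))"
  shows "LC_plus (indep_poly (concatenation G v w n))"
proof -
  interpret graph G by fact
  let ?c = "monom 1 2 * indep_poly (minus_closed_nbhd G v) * indep_poly (minus_closed_nbhd G w)"
  have fin: "finite (verts (minus_closed_nbhd G u))" for u
    by (simp add: minus_closed_nbhd_def)
  have "indep_poly (concatenation G v w n) = indep_poly G ^ (n mod 2)
    * (\<Prod>k = 1..n div 2. (indep_poly G)\<^sup>2 - smult (4 * (cos (real k * pi / real (Suc n)))\<^sup>2) ?c)"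
  proof (rule poly_linear_recurrence_factorization[where P = "\<lambda>n. indep_poly (concatenation G v w n)"])
    show "0 < poly ?c x" if "0 < x" for x
      using that by (simp add: poly_monom poly_indep_poly_pos[OF fin])
  qed (rule indep_poly_concatenation_0 indep_poly_concatenation_1[OF assms(1-3)]
      indep_poly_concatenation_Suc_Suc[OF assms(1-4)])+
  moreover have "LC_plus (indep_poly G ^ (n mod 2))"
    using LC LC_plus_1 mod2_eq_if[of n] by (cases "even n") simp_all
  moreover have "LC_plus (\<Prod>k = 1..n div 2.
      (indep_poly G)\<^sup>2 - smult (4 * (cos (real k * pi / real (Suc n)))\<^sup>2) ?c)"
  proof (rule LC_plus_prod)
    fix k
    let ?q = "(cos (real k * pi / real (Suc n)))\<^sup>2"
    have "0 \<le> ?q" "?q \<le> 1"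
      by (simp_all only: zero_le_power2 abs_square_le_1 abs_cos_le_one)
    then show "LC_plus ((indep_poly G)\<^sup>2 - smult (4 * ?q) ?c)"
      by (rule LC')
  qed
  ultimately show ?thesis
    by (simp only: LC_plus_mult)
qed

section \<open>Concatenations of trees\<close>

lemma (in pre_digraph) cas_iff_nth:
  assumes "p \<noteq> []"
  shows "cas u p v \<longleftrightarrow> tail G (p ! 0) = u \<and> head G (last p) = v
    \<and> (\<forall>i. Suc i < length p \<longrightarrow> head G (p ! i) = tail G (p ! Suc i))"
  using assms
proof (induction p arbitrary: u)
  case Nil
  then show ?case by simp
next
  case (Cons e p)
  show ?case
  proof (cases "p = []")
    case False
    have all_nat: "(\<forall>i. Q i) \<longleftrightarrow> Q 0 \<and> (\<forall>i. Q (Suc i))" for Q :: "nat \<Rightarrow> bool"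
      by (metis not0_implies_Suc)
    have "(\<forall>i. Suc i < length (e # p) \<longrightarrow> head G ((e # p) ! i) = tail G ((e # p) ! Suc i))
      \<longleftrightarrow> head G e = tail G (p ! 0)
        \<and> (\<forall>i. Suc i < length p \<longrightarrow> head G (p ! i) = tail G (p ! Suc i))"
      using False by (subst all_nat) simp
    then show ?thesis
      using Cons.IH[OF False, of "head G e"] False by (simp del: nth_Cons_Suc) auto
  qed simp
qed

text \<open>Cycles are arc lists, and the arc types of \<open>G\<close> and its concatenation
  differ; vertex sequences let cycles be transferred by adjacency alone. The value at
  \<open>m\<close> repeats \<open>c 0\<close>, hence injectivity only below
  \<open>m\<close>.\<close>

lemma (in wf_digraph) cycle_iff_vertex_sequence:
  "(\<exists>p. cycle p \<and> length p = m) \<longleftrightarrow> 0 < m \<and> (\<exists>c. c m = c 0 \<and> inj_on c {..<m}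
    \<and> (\<forall>i<m. (c i, c (Suc i)) \<in> arcs_ends G))"
    (is "?L \<longleftrightarrow> ?R")
proof
  assume ?L
  then obtain p u where p: "awalk u p u" "distinct (tl (awalk_verts u p))" "p \<noteq> []" "length p = m"
    by (auto simp: cycle_def)
  define c where "c i = awalk_verts u p ! i" for i
  have vs: "awalk_verts u p = map (tail G) p @ [u]"
    using p(1,3) by (auto simp: awalk_verts_conv awalk_def cas_iff_nth)
  have c: "c i = tail G (p ! i)" if "i < m" for i
    using that p(4) by (simp add: c_def vs nth_append)
  have cas: "tail G (p ! 0) = u" "head G (last p) = u"
    "Suc i < m \<Longrightarrow> head G (p ! i) = tail G (p ! Suc i)" for i
    using p by (auto simp: awalk_def cas_iff_nth)
  have "c m = u"
    using p(4) by (simp add: c_def vs nth_append)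
  have "0 < m" using p(3,4) by auto
  \<comment> \<open>\<open>cycle\<close> demands distinctness of the vertices after the first; for a
    closed walk these are a rotation of the list of tails.\<close>
  have "distinct (map (tail G) p)"
  proof -
    have "map (tail G) p = u # tl (map (tail G) p)"
      using p(3) cas(1) by (cases p) auto
    moreover have "tl (awalk_verts u p) = tl (map (tail G) p) @ [u]"
      using p(3) by (simp add: vs)
    ultimately show ?thesis
      using p(2) by (metis distinct.simps(2) distinct_append distinct1_rotate rotate1.simps(2))
  qed
  then have "inj_on c {..<m}"
    using p(4) by (auto simp: inj_on_def c distinct_conv_nth)
  moreover have "(c i, c (Suc i)) \<in> arcs_ends G" if "i < m" for i
  proof -
    have "p ! i \<in> arcs G"
      using p(1,4) that by (auto simp: awalk_def)
    moreover have "c (Suc i) = head G (p ! i)"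
    proof (cases "Suc i < m")
      case True
      then show ?thesis using cas(3)[OF True] by (simp add: c)
    next
      case False
      then have "Suc i = m" using that by simp
      then show ?thesis using \<open>c m = u\<close> cas(2) p(3,4) by (auto simp: last_conv_nth)
    qed
    ultimately show ?thesis
      using c[OF that] by (auto simp: arcs_ends_conv)
  qed
  moreover have "c m = c 0"
    using \<open>c m = u\<close> c[OF \<open>0 < m\<close>] cas(1) by simp
  ultimately show ?R using \<open>0 < m\<close> by blast
next
  assume ?R
  then obtain c where "0 < m" and closed: "c m = c 0" and inj: "inj_on c {..<m}"
    and "\<forall>i<m. (c i, c (Suc i)) \<in> arcs_ends G"
    by blast
  then have "\<forall>i. i < m \<longrightarrow> (\<exists>e. e \<in> arcs G \<and> tail G e = c i \<and> head G e = c (Suc i))"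
    by (metis reachableE)
  then obtain e where e: "\<And>i. i < m \<Longrightarrow> e i \<in> arcs G \<and> tail G (e i) = c i \<and> head G (e i) = c (Suc i)"
    by metis
  define p where "p = map e [0..<m]"
  have "p \<noteq> []" using \<open>0 < m\<close> by (simp add: p_def)
  have last: "head G (last p) = c 0"
    using \<open>0 < m\<close> e[of "m - 1"] closed by (simp add: p_def last_map)
  have "awalk (c 0) p (c 0)"
    unfolding awalk_def
  proof (intro conjI)
    show "c 0 \<in> verts G" using e[OF \<open>0 < m\<close>] tail_in_verts by metis
    show "set p \<subseteq> arcs G" using e by (auto simp: p_def)
    show "cas (c 0) p (c 0)"
      unfolding cas_iff_nth[OF \<open>p \<noteq> []\<close>] using last e \<open>0 < m\<close> by (simp add: p_def)
  qed
  moreover have "distinct (tl (awalk_verts (c 0) p))"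
  proof -
    have "map (tail G) p = map c [0..<m]"
      using e by (simp add: p_def)
    also have "\<dots> = c 0 # map c [1..<m]"
      using \<open>0 < m\<close> by (simp add: upt_conv_Cons)
    finally have "tl (awalk_verts (c 0) p) = map c [1..<m] @ [c 0]"
      using \<open>p \<noteq> []\<close> last by (simp add: awalk_verts_conv)
    moreover have "c 0 \<notin> c ` {1..<m}" "inj_on c {1..<m}"
      using inj \<open>0 < m\<close> by (fastforce simp: inj_on_def)+
    ultimately show ?thesis by (simp add: distinct_map)
  qed
  ultimately have "cycle p"
    using \<open>p \<noteq> []\<close> unfolding cycle_def by blast
  then show ?L by (auto simp: p_def)
qed

text \<open>A discrete intermediate value principle, which locates the step at which a walk crosses
  a bridge.\<close>

lemma ex_step_between:
  fixes j k :: nat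
  assumes "j \<le> k" and "P j" and "\<not> P k"
  obtains i where "j \<le> i" and "i < k" and "P i" and "\<not> P (Suc i)"
  using assms(1,3)
proof (induction k arbitrary: thesis rule: dec_induct)
  case base
  then show ?case using \<open>P j\<close> by simp
next
  case (step k)
  then show ?case by (cases "P k") (auto intro: less_SucI)
qed

text \<open>
  A bridge is crossed in both directions by a closed walk that meets both of its sides, so its two
  end points are consecutive in both cyclic orders.
\<close>

lemma cycle_bridge:
  fixes c :: "nat \<Rightarrow> 'v"
  assumes closed: "c m = c 0" and inj: "inj_on c {..<m}" and "3 \<le> m"
    and arc: "\<And>i. i < m \<Longrightarrow> (c i, c (Suc i)) \<in> E"
    and out: "\<And>x y. (x, y) \<in> E \<Longrightarrow> x \<in> A \<Longrightarrow> y \<notin> A \<Longrightarrow> x = a \<and> y = b"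
    and into: "\<And>x y. (x, y) \<in> E \<Longrightarrow> x \<notin> A \<Longrightarrow> y \<in> A \<Longrightarrow> x = b \<and> y = a"
    and jk: "j \<le> m" "k \<le> m" "c j \<in> A"
  shows "c k \<in> A"
proof (rule ccontr)
  assume "c k \<notin> A"
  \<comment> \<open>The walk is read cyclically: if \<open>k\<close> precedes \<open>j\<close>, the
    change of \<open>P\<close> occurs between 0 and \<open>k\<close> or between \<open>j\<close> and
    \<open>m\<close>, according to whether \<open>P\<close> holds at
    \<open>c 0 = c m\<close>.\<close>
  have cross: "\<exists>i<m. P (c i) \<and> \<not> P (c (Suc i))" if "P (c j)" "\<not> P (c k)" "j \<le> m" "k \<le> m" for P j k
  proof (cases "j \<le> k")
    case True
    then show ?thesis
      using ex_step_between[of j k "\<lambda>i. P (c i)"] that by (metis order.strict_trans2)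
  next
    case False
    show ?thesis
    proof (cases "P (c 0)")
      case True
      then show ?thesis
        using ex_step_between[of 0 k "\<lambda>i. P (c i)"] that by (metis order.strict_trans2 zero_le)
    next
      case False
      then show ?thesis
        using ex_step_between[of j m "\<lambda>i. P (c i)"] that closed by (metis order.strict_trans2)
    qed
  qed
  obtain s where s: "s < m" "c s \<in> A" "c (Suc s) \<notin> A"
    using cross[of "\<lambda>x. x \<in> A" j k] jk \<open>c k \<notin> A\<close> by blast
  obtain t where t: "t < m" "c t \<notin> A" "c (Suc t) \<in> A"
    using cross[of "\<lambda>x. x \<notin> A" k j] jk \<open>c k \<notin> A\<close> by blast
  have "c s = a" "c (Suc s) = b" "c t = b" "c (Suc t) = a"
    using out[OF arc s(2,3)] into[OF arc t(2,3)] s t by auto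
  then have eq: "c (Suc s) = c t" "c (Suc t) = c s" by simp_all
  have next_eq: "j = Suc i \<or> j = 0 \<and> Suc i = m" if "i < m" "j < m" "c (Suc i) = c j" for i j
  proof (cases "Suc i < m")
    case True
    then show ?thesis using inj that by (auto simp: inj_on_def)
  next
    case False
    then have "Suc i = m" using that by simp
    then have "c 0 = c j" using closed that by simp
    then have "j = 0" using inj that by (auto simp: inj_on_def)
    then show ?thesis using \<open>Suc i = m\<close> by simp
  qed
  \<comment> \<open>Here \<open>s\<close> and \<open>t\<close> would each be the cyclic successor of
    the other, which forces \<open>m\<close> to be at most 2.\<close>
  show False
    using next_eq[OF s(1) t(1) eq(1)] next_eq[OF t(1) s(1) eq(2)] \<open>3 \<le> m\<close> by linarith
qed

section \<open>Connectedness and acyclicity of concatenations\<close>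

lemma reachable_concatenation_same_copy:
  assumes "graph G" and "v \<in> verts G" and "w \<in> verts G" and "x \<rightarrow>\<^sup>*\<^bsub>G\<^esub> y" and "i \<in> {1..n}"
  shows "(x, i) \<rightarrow>\<^sup>*\<^bsub>concatenation G v w n\<^esub> (y, i)"
proof -
  interpret graph G by fact
  interpret H: graph "concatenation G v w n"
    using assms(1-3) by (rule graph_concatenation)
  show ?thesis
    using assms(4)
  proof (induction rule: reachable_induct)
    case base
    then show ?case using assms(5) by (intro H.reachable_refl) (simp add: verts_concatenation)
  next
    case (step y z)
    then have "((y, i), (z, i)) \<in> arcs_ends (concatenation G v w n)"
      using assms(5) by (simp add: adj_concatenation)
    then show ?case using step by (metis H.reachable_adj_trans)
  qed
qed

text \<open>From \<open>(v, 1)\<close> the next copy is reached by walking to \<open>w\<close> and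
  crossing the linking edge; by symmetry any two vertices are joined through
  \<open>(v, 1)\<close>.\<close>

lemma reachable_concatenation:
  assumes "graph G" and vw: "v \<in> verts G" "w \<in> verts G"
    and conn: "\<forall>x\<in>verts G. \<forall>y\<in>verts G. x \<rightarrow>\<^sup>*\<^bsub>G\<^esub> y"
    and pq: "p \<in> verts (concatenation G v w n)" "q \<in> verts (concatenation G v w n)"
  shows "p \<rightarrow>\<^sup>*\<^bsub>concatenation G v w n\<^esub> q"
proof -
  let ?H = "concatenation G v w n"
  interpret H: graph ?H
    using assms(1-3) by (rule graph_concatenation)
  have sym: "y \<rightarrow>\<^sup>*\<^bsub>?H\<^esub> x" if "x \<rightarrow>\<^sup>*\<^bsub>?H\<^esub> y" for x y
    using H.sym_arcs that by (rule symmetric_reachable)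
  have base: "(v, 1) \<rightarrow>\<^sup>*\<^bsub>?H\<^esub> (x, i)" if "1 \<le> i" "i \<le> n" "x \<in> verts G" for x i
    using that
  proof (induction i arbitrary: x rule: dec_induct)
    case base
    then show ?case
      using conn vw by (intro reachable_concatenation_same_copy[OF assms(1-3)]) auto
  next
    case (step i)
    have "(v, 1) \<rightarrow>\<^sup>*\<^bsub>?H\<^esub> (w, i)"
      using step vw by simp
    also have "(w, i) \<rightarrow>\<^bsub>?H\<^esub> (v, Suc i)"
      using step by (simp add: adj_concatenation)
    also have "(v, Suc i) \<rightarrow>\<^sup>*\<^bsub>?H\<^esub> (x, Suc i)"
      using step conn vw by (intro reachable_concatenation_same_copy[OF assms(1-3)]) auto
    finally show ?case .
  qed
  have "(v, 1) \<rightarrow>\<^sup>*\<^bsub>?H\<^esub> p" "(v, 1) \<rightarrow>\<^sup>*\<^bsub>?H\<^esub> q"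
    using base[of "snd p" "fst p"] base[of "snd q" "fst q"] pq
    by (auto simp: verts_concatenation)
  then show ?thesis
    using sym H.reachable_trans by blast
qed

text \<open>Every linking edge is a bridge, so a cycle of length at least three stays in one copy,
  and forgetting the copy number keeps its vertices distinct.\<close>

lemma cycle_concatenation:
  assumes "graph G" and vw: "v \<in> verts G" "w \<in> verts G"
    and "pre_digraph.cycle (concatenation G v w n) p" and "3 \<le> length p"
  shows "\<exists>p'. pre_digraph.cycle G p' \<and> length p' = length p"
proof -
  let ?H = "concatenation G v w n"
  interpret graph G by fact
  interpret H: graph ?H
    using assms(1-3) by (rule graph_concatenation)
  define m where "m = length p"
  have "3 \<le> m" using assms(5) by (simp add: m_def)
  obtain c where closed: "c m = c 0" and inj: "inj_on c {..<m}"
    and arc: "\<And>i. i < m \<Longrightarrow> (c i, c (Suc i)) \<in> arcs_ends ?H"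
    using H.cycle_iff_vertex_sequence[of m] assms(4) m_def by blast
  have level: "snd (c k) \<le> snd (c j)" if "j \<le> m" "k \<le> m" for j k
  proof -
    \<comment> \<open>At most one linking edge joins the copies up to the level of
      \<open>c j\<close> to the later ones, so the cycle never rises above that level; as
      \<open>j\<close> and \<open>k\<close> are arbitrary, the level is constant.\<close>
    have "c k \<in> {x. snd x \<le> snd (c j)}"
      by (rule cycle_bridge[OF closed inj \<open>3 \<le> m\<close> arc, where a = "(w, snd (c j))"
            and b = "(v, Suc (snd (c j)))" and j = j])
        (use that in \<open>auto simp: adj_concatenation\<close>)
    then show ?thesis by simp
  qed
  then have level: "snd (c j) = snd (c k)" if "j \<le> m" "k \<le> m" for j k
    using that by (intro antisym) auto
  let ?c = "\<lambda>i. fst (c i)"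
  have "?c m = ?c 0"
    using closed by simp
  moreover have "inj_on ?c {..<m}"
    using inj level by (auto simp: inj_on_def prod_eq_iff)
  moreover have "(?c i, ?c (Suc i)) \<in> arcs_ends G" if "i < m" for i
    using arc[OF that] level[of i "Suc i"] that
    by (cases "c i"; cases "c (Suc i)") (auto simp: adj_concatenation)
  ultimately have "\<exists>p'. cycle p' \<and> length p' = m"
    using cycle_iff_vertex_sequence[of m] \<open>3 \<le> m\<close>
    by (metis (no_types, lifting) gr0I not_numeral_le_zero)
  then show ?thesis by (simp only: m_def)
qed

lemma undirected_tree_concatenation:
  assumes "undirected_tree G" and "v \<in> verts G" and "w \<in> verts G"
  shows "undirected_tree (concatenation G v w n)"
  unfolding undirected_tree_def
proof (intro conjI ballI)
  have G: "graph G" and conn: "\<forall>x\<in>verts G. \<forall>y\<in>verts G. x \<rightarrow>\<^sup>*\<^bsub>G\<^esub> y"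
    and acyclic: "\<not> (\<exists>p. pre_digraph.cycle G p \<and> 3 \<le> length p)"
    using assms(1) by (simp_all add: undirected_tree_def)
  show "graph (concatenation G v w n)"
    using G assms(2,3) by (rule graph_concatenation)
  show "p \<rightarrow>\<^sup>*\<^bsub>concatenation G v w n\<^esub> q"
    if "p \<in> verts (concatenation G v w n)" "q \<in> verts (concatenation G v w n)" for p q
    using G assms(2,3) conn that by (rule reachable_concatenation)
  show "\<not> (\<exists>p. pre_digraph.cycle (concatenation G v w n) p \<and> 3 \<le> length p)"
    using cycle_concatenation[OF G assms(2,3)] acyclic by metis
qed

theorem theorem1p8:
  fixes G :: "('a, 'b) pre_digraph" and v w :: 'a
  assumes "graph G"
    and "v \<in> verts G" and "w \<in> verts G" and "(v, w) \<in> arcs_ends G"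
    and "LC_plus (indep_poly G)"
    and "\<And>q :: real. 0 \<le> q \<Longrightarrow> q \<le> 1 \<Longrightarrow>
      LC_plus ((indep_poly G)\<^sup>2
        - smult (4 * q) (monom 1 2 * indep_poly (minus_closed_nbhd G v)
            * indep_poly (minus_closed_nbhd G w)))"
  shows "\<forall>n. log_concave_seq (\<lambda>t. real (indep_count (concatenation G v w n) t))
            (indep_number (concatenation G v w n))
        \<and> unimodal_seq (\<lambda>t. real (indep_count (concatenation G v w n) t))
            (indep_number (concatenation G v w n))
        \<and> (undirected_tree G \<longrightarrow> undirected_tree (concatenation G v w n))"
proof (intro allI conjI impI)
  fix n
  let ?H = "concatenation G v w n"
  interpret H: graph ?H
    using assms(1-3) by (rule graph_concatenation)
  have LC: "LC_plus (indep_poly ?H)"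
    using assms by (rule LC_plus_indep_poly_concatenation)
  \<comment> \<open>The coefficients are the counts and the degree is the independence number, so
    \<open>LC_plus\<close> speaks about the independent set sequence itself.\<close>
  show lc: "log_concave_seq (\<lambda>t. real (indep_count ?H t)) (indep_number ?H)"
    using LC by (simp add: LC_plus_def log_concave_seq_def coeff_indep_poly degree_indep_poly)
  show "unimodal_seq (\<lambda>t. real (indep_count ?H t)) (indep_number ?H)"
    using LC by (intro log_concave_seq_imp_unimodal_seq lc)
      (simp add: LC_plus_def coeff_indep_poly degree_indep_poly)
  show "undirected_tree ?H" if "undirected_tree G"
    using that assms(2,3) by (rule undirected_tree_concatenation)
qed

end
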